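(* For all integers $n\ge 1$, \[ R(n)=\exp\left(\sum_{k=0}^{n-1}\log\bigl(h(T^k(0))\bigr)\right), \] where $R$ is the Fibonacci partition function, $T$ is the rotation by $1/\varphi^2$ on $\left[-\frac1{\varphi^2},\frac1\varphi\right)$ and $h$ is the function defined in the context.
   Context: Let $\varphi=\frac{1+\sqrt5}{2}$. Fibonacci numbers: $F_1=F_2=1$, $F_{m+2}=F_{m+1}+F_m$. For an integer $n\ge 0$, $R(n)$ is the number of ways of writing $n=x_1+\cdots+x_s$ with $x_1<x_2<\cdots<x_s$ distinct Fibonacci numbers (i.e. the number of finite subsets $S\subset\{2,3,4,\dots\}$ with $\sum_{i\in S}F_i=n$; $R(0)=1$). The map $T:\left[-\frac{1}{\varphi^2},\frac1\varphi\right)\to\left[-\frac{1}{\varphi^2},\frac1\varphi\right)$ is \[ T(y)=\begin{cases} y+\frac1{\varphi^2}, & y\in\left[-\frac1{\varphi^2},\frac1{\varphi^3}\right),\\ y+\frac1{\varphi^2}-1, & y\in\left[\frac1{\varphi^3},\frac1\varphi\right).\end{cases} \] The function $h:\left(-\frac1{\varphi^2},\frac1{\varphi^3}\right)\cup\left(\frac1{\varphi^3},\frac1\varphi\right)\to\mathbb R$ is the unique continuous function satisfying \[ h(y)=\begin{cases} 1+h(-\varphi y), & y\in\left(-\frac1{\varphi^2},-\frac1{\varphi^4}\right),\\ 1, & y\in\left[-\frac1{\varphi^4},0\right],\\ \dfrac{h\left(-\varphi y+\frac1\varphi\right)}{1+h\left(-\varphi y+\frac1\varphi\right)}, & y\in\left(0,\frac1{\varphi^3}\right),\\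 h\left(-\varphi y+\frac1\varphi\right), & y\in\left(\frac1{\varphi^3},\frac1\varphi\right). \end{cases} \] *)

theory Defs
  imports "HOL-Analysis.Analysis" "HOL-Number_Theory.Fib" "HOL-Library.FuncSet"
begin

definition golden :: real ("\<phi>") where
  "\<phi> = (1 + sqrt 5) / 2"

text \<open>Representations are index sets; indices start at 2 because \<open>fib 1 = fib 2 = 1\<close>.\<close>

definition R :: "nat \<Rightarrow> nat" where
  "R n = card {S. finite S \<and> S \<subseteq> {2..} \<and> (\<Sum>i\<in>S. fib i) = n}"

text \<open>Only the values on the invariant interval \<open>{-1/\<phi>^2 ..< 1/\<phi>}\<close> are meaningful.\<close>

definition T :: "real \<Rightarrow> real" where
  "T y = (if y < 1/\<phi>^3 then y + 1/\<phi>^2 else y + 1/\<phi>^2 - 1)"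

definition h_dom :: "real set" where
  "h_dom = {-1/\<phi>^2 <..< 1/\<phi>^3} \<union> {1/\<phi>^3 <..< 1/\<phi>}"

definition h_equations :: "(real \<Rightarrow> real) \<Rightarrow> bool" where
  "h_equations h \<longleftrightarrow>
     (\<forall>y \<in> {-1/\<phi>^2 <..< -1/\<phi>^4}. h y = 1 + h (-\<phi>*y)) \<and>
     (\<forall>y \<in> {-1/\<phi>^4 .. 0}. h y = 1) \<and>
     (\<forall>y \<in> {0 <..< 1/\<phi>^3}. h y = h (-\<phi>*y + 1/\<phi>) / (1 + h (-\<phi>*y + 1/\<phi>))) \<and>
     (\<forall>y \<in> {1/\<phi>^3 <..< 1/\<phi>}. h y = h (-\<phi>*y + 1/\<phi>))"

text \<open>
  The unique continuous solution of the functional equations on \<open>h_dom\<close>. A function on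
  \<open>h_dom\<close> is represented by its extensional extension to the reals, so that uniqueness
  on \<open>h_dom\<close> is uniqueness of the HOL function. The denominators \<open>1 + h _\<close> cause no
  ambiguity: iterating the equations reaches \<open>{-1/\<phi>^4 .. 0}\<close> from a dense set of points,
  where \<open>h > 0\<close> follows, so every continuous solution is nonnegative.
\<close>

definition h :: "real \<Rightarrow> real" where
  "h = (THE f. f \<in> extensional h_dom \<and> continuous_on h_dom f \<and> h_equations f)"

end

theory Submission
  imports Defs "HOL-Analysis.Kronecker_Approximation_Theorem"
begin

text \<open>
  The product over \<open>k\<close> telescopes: with \<open>y\<^sub>k = T^k(0)\<close>, the theorem says that
  \<open>h(y\<^sub>k) = R(k+1)/R(k)\<close>. So the content is that these ratios, placed at the points \<open>y\<^sub>k\<close>,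
  satisfy the functional equations of \<open>h\<close>, and that \<open>h\<close> exists.

  Arithmetic of \<open>R\<close>. Write \<open>y\<^sub>k = a(k) - k\<phi>\<close> with integral \<open>a(k)\<close>; the function \<open>a\<close> is
  \<open>fib_shift\<close>. Since \<open>F\<^sub>i\<^sub>+\<^sub>1 - \<phi> F\<^sub>i = (1 - \<phi>)^i\<close>, and a sum of distinct such powers with
  \<open>i \<ge> 2\<close> lies in the interval of \<open>T\<close>, which has length one, raising all indices of any
  representation of \<open>k\<close> by one gives a representation of \<open>a(k)\<close>
  (\<open>sum_fib_Suc_eq_fib_shift\<close>). Hence \<open>a(k)\<close> has exactly \<open>R(k)\<close> representations with indices
  at least 3, and numbers outside the range of \<open>a\<close> have none. Every \<open>n\<close> is \<open>a(j)\<close> or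
  \<open>a(j) + 1\<close>, so sorting representations by whether they use \<open>F\<^sub>2 = 1\<close> expresses \<open>R(n)\<close> and
  \<open>R(n+1)\<close> by values of \<open>R\<close> near \<open>j\<close>. At the level of the orbit, passing from \<open>n\<close> to \<open>j\<close>
  multiplies by \<open>-\<phi>\<close>, up to a translation, exactly as the functional equations do. By
  strong induction every solution of the equations takes the value
  \<open>R(k+1)/R(k)\<close> at \<open>y\<^sub>k\<close> (\<open>h_equations_orbit\<close>).

  Uniqueness of \<open>h\<close>. The orbit of 0 under an irrational rotation is dense, so two continuous
  solutions agree.

  Existence of \<open>h\<close>. In the bounded coordinate \<open>v = h/(1+h)\<close> the maps \<open>h \<mapsto> 1 + h\<close> and
  \<open>h \<mapsto> h/(1+h)\<close> become \<open>v \<mapsto> 1/(2-v)\<close> and \<open>v \<mapsto> v/(1+v)\<close>, which are the inverse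
  branches of the Farey map, the first one composed with \<open>v \<mapsto> 1 - v\<close>. Neither contracts by
  a constant factor, as 1 and 0 are neutral fixed points, but both turn a distance \<open>d\<close> into
  at most \<open>d/(1+d)\<close>. Iterating the equations \<open>n\<close> times therefore determines \<open>v\<close> up to an error \<open>1/(n+1)\<close>, uniformly, and the iterates of a
  continuous function converge to a continuous solution (\<open>farey_step_fixed_point\<close>).
\<close>

section \<open>Arithmetic of the golden ratio\<close>

lemma golden_square: "\<phi> * \<phi> = \<phi> + 1"
  unfolding golden_def by (simp add: field_simps)

lemma golden_bounds: "8/5 < \<phi>" "\<phi> < 13/8"
proof -
  have "11/5 < sqrt 5" by (rule real_less_rsqrt) (simp add: power2_eq_square)
  then show "8/5 < \<phi>" unfolding golden_def by simp
  have "sqrt 5 < 9/4" by (rule real_less_lsqrt) (simp_all add: power2_eq_square)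
  then show "\<phi> < 13/8" unfolding golden_def by simp
qed

lemma golden_inverse_powers:
  "1/\<phi> = \<phi> - 1" "1/\<phi>^2 = 2 - \<phi>" "1/\<phi>^3 = 2*\<phi> - 3" "1/\<phi>^4 = 5 - 3*\<phi>"
  "-1/\<phi>^2 = \<phi> - 2" "-1/\<phi>^4 = 3*\<phi> - 5"
proof -
  have nz: "\<phi> \<noteq> 0" using golden_bounds by simp
  show 1: "1/\<phi> = \<phi> - 1" using nz golden_square by (simp add: field_simps)
  have step: "1/\<phi>^Suc n = (\<phi> - 1) * (1/\<phi>^n)" for n
    unfolding 1[symmetric] by simp
  show 2: "1/\<phi>^2 = 2 - \<phi>"
    using step[of 1] 1 golden_square by (simp add: algebra_simps numeral_2_eq_2)
  have "1/\<phi>^3 = (\<phi> - 1) * (2 - \<phi>)"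
    using step[of 2] unfolding 2 by (simp add: numeral_3_eq_3)
  then show 3: "1/\<phi>^3 = 2*\<phi> - 3"
    using golden_square by (simp add: algebra_simps)
  have "1/\<phi>^4 = (\<phi> - 1) * (2*\<phi> - 3)"
    using step[of 3] unfolding 3 by simp
  then show 4: "1/\<phi>^4 = 5 - 3*\<phi>"
    using golden_square by (simp add: algebra_simps)
  show "-1/\<phi>^2 = \<phi> - 2" "-1/\<phi>^4 = 3*\<phi> - 5"
    using 2 4 by (simp_all add: minus_divide_left[symmetric])
qed

lemma golden_irrational: "\<phi> \<notin> \<rat>"
proof
  assume "\<phi> \<in> \<rat>"
  then obtain m n :: nat where n: "n \<noteq> 0" and eq: "\<bar>\<phi>\<bar> = m / n" and cop: "coprime m n"
    by (rule Rats_abs_nat_div_natE)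
  have m: "real m = \<phi> * n" using eq n golden_bounds by (simp add: field_simps)
  have "real (m * m) = (\<phi> * \<phi>) * n * n" using m by simp
  also have "\<dots> = real (m * n + n * n)" using m golden_square by (simp add: algebra_simps)
  finally have mm: "m * m = m * n + n * n" using of_nat_eq_iff by blast
  have "n dvd m * m" unfolding mm by simp
  \<comment> \<open>So \<open>n = 1\<close> and \<open>\<phi>\<close> would be an integer strictly between 1 and 2.\<close>
  moreover have "coprime (m * m) n" using cop by simp
  ultimately have "n dvd 1" by (meson coprime_common_divisor dvd_refl)
  then have "n = 1" by simp
  then have "real m = \<phi>" using m by simp
  then have "1 < m" "m < 2" using golden_bounds by linarith+
  then show False by simp
qed

lemma golden_multiple_not_int:
  assumes "k \<noteq> 0"
  shows "of_int k * \<phi> \<noteq> of_int m"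
proof
  assume "of_int k * \<phi> = of_int m"
  then have "\<phi> = of_int m / of_int k" using assms by (simp add: field_simps)
  then show False using golden_irrational by (metis Rats_divide Rats_of_int)
qed

lemma T_golden: "T y = (if y < 2*\<phi> - 3 then y + 2 - \<phi> else y + 1 - \<phi>)"
  unfolding T_def golden_inverse_powers by simp

lemma h_dom_golden: "h_dom = {\<phi> - 2 <..< 2*\<phi> - 3} \<union> {2*\<phi> - 3 <..< \<phi> - 1}"
  unfolding h_dom_def golden_inverse_powers ..

lemma h_equations_golden:
  "h_equations f \<longleftrightarrow>
     (\<forall>y \<in> {\<phi> - 2 <..< 3*\<phi> - 5}. f y = 1 + f (-\<phi>*y)) \<and>
     (\<forall>y \<in> {3*\<phi> - 5 .. 0}. f y = 1) \<and>
     (\<forall>y \<in> {0 <..< 2*\<phi> - 3}. f y = f (-\<phi>*y + \<phi> - 1) / (1 + f (-\<phi>*y + \<phi> - 1))) \<and>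
     (\<forall>y \<in> {2*\<phi> - 3 <..< \<phi> - 1}. f y = f (-\<phi>*y + \<phi> - 1))"
  unfolding h_equations_def golden_inverse_powers by (simp add: add_diff_eq)

section \<open>The orbit of zero and the Fibonacci shift\<close>

text \<open>
  Since \<open>1/\<phi>^2 = 2 - \<phi>\<close>, each application of \<open>T\<close> subtracts \<open>\<phi>\<close> and adds 2 or 1;
  \<open>fib_shift k\<close> accumulates these integers. It starts \<open>0, 2, 3, 5, 7, 8\<close> and turns out to be
  the map that raises every index in a Fibonacci representation by one.
\<close>

fun fib_shift :: "nat \<Rightarrow> nat" where
  "fib_shift 0 = 0"
| "fib_shift (Suc k) = (if (T ^^ k) 0 < 2*\<phi> - 3 then fib_shift k + 2 else fib_shift k + 1)"

lemma orbit_eq: "(T ^^ k) 0 = real (fib_shift k) - real k * \<phi>"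
proof (induction k)
  case (Suc k)
  then show ?case using T_golden[of "(T ^^ k) 0"] by (simp add: algebra_simps)
qed simp

text \<open>
  The half-open interval is invariant. The orbit avoids its left end and the discontinuity of
  \<open>T\<close> because hitting them would make \<open>(k + 1) \<phi>\<close> or \<open>(k + 2) \<phi>\<close> an integer.
\<close>

lemma orbit_range: "\<phi> - 2 < (T ^^ k) 0" "(T ^^ k) 0 < \<phi> - 1" "(T ^^ k) 0 \<noteq> 2*\<phi> - 3"
proof -
  have "\<phi> - 2 \<le> (T ^^ k) 0 \<and> (T ^^ k) 0 < \<phi> - 1"
    using golden_bounds by (induction k) (auto simp: T_golden)
  moreover have "(T ^^ k) 0 \<noteq> \<phi> - 2"
    using golden_multiple_not_int[of "int k + 1" "int (fib_shift k) + 2"]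
    by (auto simp: orbit_eq algebra_simps)
  ultimately show "\<phi> - 2 < (T ^^ k) 0" "(T ^^ k) 0 < \<phi> - 1" by auto
  show "(T ^^ k) 0 \<noteq> 2*\<phi> - 3"
    using golden_multiple_not_int[of "int k + 2" "int (fib_shift k) + 3"]
    by (auto simp: orbit_eq algebra_simps)
qed

text \<open>
  The interval of \<open>T\<close> has length one, so it contains at most one of the numbers \<open>n - k \<phi>\<close>
  with integral \<open>n\<close>.
\<close>

lemma fib_shift_unique:
  assumes "\<phi> - 2 < real n - real k * \<phi>" "real n - real k * \<phi> < \<phi> - 1"
  shows "n = fib_shift k"
  using assms orbit_range[of k] unfolding orbit_eq by linarith

lemma strict_mono_fib_shift: "strict_mono fib_shift"
  by (rule strict_mono_Suc_iff[THEN iffD2]) auto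

lemma less_fib_shift:
  assumes "0 < k"
  shows "k < fib_shift k"
  using assms
proof (induction k)
  case (Suc k)
  then show ?case using golden_bounds by (cases "k = 0") auto
qed simp

text \<open>
  Consecutive values of \<open>fib_shift\<close> differ by 1 or 2, and by 2 exactly after a point of the
  orbit below \<open>1/\<phi>^3 = 2\<phi> - 3\<close>.
\<close>

lemma fib_shift_covers:
  obtains j where "n = fib_shift j"
  | j where "n = fib_shift j + 1" "(T ^^ j) 0 < 2*\<phi> - 3"
proof -
  have "(\<exists>j. n = fib_shift j) \<or> (\<exists>j. n = fib_shift j + 1 \<and> (T ^^ j) 0 < 2*\<phi> - 3)"
  proof (induction n)
    case 0
    then show ?case by (metis fib_shift.simps(1))
  next
    case (Suc n)
    then show ?case
    proof (elim disjE exE conjE)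
      fix j assume "n = fib_shift j"
      then show ?thesis
        by (cases "(T ^^ j) 0 < 2*\<phi> - 3") (auto intro: exI[of _ "Suc j"] exI[of _ j])
    next
      fix j assume "n = fib_shift j + 1" "(T ^^ j) 0 < 2*\<phi> - 3"
      then have "Suc n = fib_shift (Suc j)" by simp
      then show ?thesis by blast
    qed
  qed
  then show thesis using that by blast
qed

lemma fib_shift_gap:
  assumes "(T ^^ j) 0 < 2*\<phi> - 3"
  shows "fib_shift j + 1 \<notin> range fib_shift"
proof
  assume "fib_shift j + 1 \<in> range fib_shift"
  then obtain i where i: "fib_shift i = fib_shift j + 1" by (metis rangeE)
  have "fib_shift (Suc j) = fib_shift j + 2" using assms by simp
  then have "fib_shift j < fib_shift i" "fib_shift i < fib_shift (Suc j)" using i by linarith+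
  then have "j < i" "i < Suc j" using strict_mono_less[OF strict_mono_fib_shift] by blast+
  then show False by simp
qed

section \<open>Shifting Fibonacci representations\<close>

definition fib_reps :: "nat \<Rightarrow> nat \<Rightarrow> nat set set" where
  "fib_reps m n = {S. finite S \<and> S \<subseteq> {m..} \<and> (\<Sum>i\<in>S. fib i) = n}"

lemma R_eq_card: "R n = card (fib_reps 2 n)"
  unfolding R_def fib_reps_def ..

text \<open>
  This makes the indices in a representation of \<open>n\<close> bounded in terms of \<open>n\<close>, so that the
  cardinality defining \<open>R\<close> counts a finite set.
\<close>

lemma le_Suc_fib: "i \<le> Suc (fib i)"
proof (induction i rule: fib.induct)
  case (3 n)
  then show ?case by (cases "n = 0") (use fib_neq_0_nat[of n] in auto)
qed auto

lemma finite_fib_reps: "finite (fib_reps m n)"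
proof (rule finite_subset)
  show "fib_reps m n \<subseteq> Pow {..Suc n}"
  proof
    fix S assume "S \<in> fib_reps m n"
    then have S: "finite S" "(\<Sum>i\<in>S. fib i) = n" by (auto simp: fib_reps_def)
    have "i \<le> Suc n" if "i \<in> S" for i
      using member_le_sum[of i S fib] that S le_Suc_fib[of i] by simp
    then show "S \<in> Pow {..Suc n}" by auto
  qed
qed simp

lemma R_zero: "R 0 = 1"
proof -
  have "S = {}" if "S \<in> fib_reps m 0" "m > 0" for S m
  proof (rule equals0I)
    fix i assume "i \<in> S"
    then have "fib i = 0" "0 < i" using that by (auto simp: fib_reps_def)
    then show False using fib_neq_0_nat[of i] by simp
  qed
  moreover have "{} \<in> fib_reps m 0" for m by (simp add: fib_reps_def)
  ultimately have "fib_reps m 0 = {{}}" if "m > 0" for m using that by blast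
  then show ?thesis by (simp add: R_eq_card)
qed

text \<open>
  A representation either avoids the index 2 or contains it; in the latter case removing the
  part \<open>F\<^sub>2 = 1\<close> leaves a representation of the predecessor.
\<close>

lemma R_Suc: "R (Suc n) = card (fib_reps 3 (Suc n)) + card (fib_reps 3 n)"
proof -
  have not2: "2 \<notin> S" if "S \<in> fib_reps 3 k" for S k
    using that by (auto simp: fib_reps_def)
  have "fib_reps 2 (Suc n) = fib_reps 3 (Suc n) \<union> insert 2 ` fib_reps 3 n" (is "?L = ?A \<union> ?B")
  proof
    show "?A \<union> ?B \<subseteq> ?L"
    proof
      fix S assume "S \<in> ?A \<union> ?B"
      then show "S \<in> ?L"
      proof
        assume "S \<in> ?A"
        then show ?thesis by (auto simp: fib_reps_def)
      next
        assume "S \<in> ?B"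
        then obtain S' where S': "S' \<in> fib_reps 3 n" "S = insert 2 S'" by blast
        then show ?thesis using not2[OF S'(1)] by (auto simp: fib_reps_def)
      qed
    qed
    show "?L \<subseteq> ?A \<union> ?B"
    proof
      fix S assume "S \<in> ?L"
      then have S: "finite S" "S \<subseteq> {2..}" "(\<Sum>i\<in>S. fib i) = Suc n" by (auto simp: fib_reps_def)
      have sub: "S - {2} \<subseteq> {3..}"
      proof
        fix i assume "i \<in> S - {2}"
        then have "i \<ge> 2" "i \<noteq> 2" using S(2) by auto
        then show "i \<in> {3..}" by simp
      qed
      show "S \<in> ?A \<union> ?B"
      proof (cases "2 \<in> S")
        case True
        then have "(\<Sum>i\<in>S - {2}. fib i) = n" using S by (simp add: sum_diff1_nat)
        then have "S - {2} \<in> fib_reps 3 n" using S(1) sub by (simp add: fib_reps_def)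
        moreover have "S = insert 2 (S - {2})" using True by blast
        ultimately show ?thesis by blast
      next
        case False
        then show ?thesis using S sub by (simp add: fib_reps_def)
      qed
    qed
  qed
  moreover have "?A \<inter> ?B = {}" using not2 by blast
  moreover have "inj_on (insert 2) (fib_reps 3 n)"
    using not2 by (intro inj_onI) (metis insert_ident)
  ultimately show ?thesis
    by (simp add: R_eq_card card_Un_disjoint finite_fib_reps card_image)
qed

text \<open>
  Both sides satisfy the Fibonacci recurrence, because \<open>1 - \<phi> = -1/\<phi>\<close> is the other root of
  \<open>x^2 = x + 1\<close>.
\<close>

lemma fib_Suc_conjugate: "real (fib (Suc i)) - \<phi> * real (fib i) = (1 - \<phi>) ^ i"
proof (induction i rule: fib.induct)
  case (3 n)
  have "(1 - \<phi>)^Suc (Suc n) = (1 - \<phi>) * (1 - \<phi>) * (1 - \<phi>)^n" by simp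
  also have "(1 - \<phi>) * (1 - \<phi>) = (1 - \<phi>) + 1" using golden_square by (simp add: algebra_simps)
  also have "((1 - \<phi>) + 1) * (1 - \<phi>)^n = (1 - \<phi>)^Suc n + (1 - \<phi>)^n" by (simp add: algebra_simps)
  finally show ?case using 3 by (simp add: algebra_simps)
qed auto

text \<open>
  The quotient \<open>t\<close> by the lowest admissible power obeys \<open>t = \<epsilon> + (1 - \<phi>) t'\<close> with
  \<open>\<epsilon> \<in> {0, 1}\<close> and \<open>t'\<close> the quotient for the higher powers. Multiplication by \<open>1 - \<phi>\<close> maps
  \<open>(-1, \<phi>)\<close> onto \<open>(-1, \<phi> - 1)\<close>, so \<open>(-1, \<phi>)\<close> is preserved by both choices of \<open>\<epsilon>\<close>.
\<close>

lemma conjugate_power_sum_bounds: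
  assumes "finite S" "S \<subseteq> {m..}"
  shows "\<exists>t. (\<Sum>i\<in>S. (1 - \<phi>) ^ i) = (1 - \<phi>) ^ m * t \<and> -1 < t \<and> t < \<phi>"
proof -
  have "\<exists>t. (\<Sum>i\<in>S. (1 - \<phi>) ^ i) = (1 - \<phi>) ^ m * t \<and> -1 < t \<and> t < \<phi>"
    if "S \<subseteq> {m..<m+N}" for N
    using that
  proof (induction N arbitrary: m S)
    case 0
    then show ?case using golden_bounds by (intro exI[of _ 0]) auto
  next
    case (Suc N)
    have "S - {m} \<subseteq> {Suc m..<Suc m + N}" using Suc.prems by force
    from Suc.IH[OF this] obtain t where
      t: "(\<Sum>i\<in>S - {m}. (1 - \<phi>) ^ i) = (1 - \<phi>) ^ Suc m * t" "-1 < t" "t < \<phi>" by blast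
    have fin: "finite S" using Suc.prems finite_subset by blast
    have "(\<phi> - 1) * t < (\<phi> - 1) * \<phi>" "(\<phi> - 1) * (-1) < (\<phi> - 1) * t"
      using t(2,3) golden_bounds by (intro mult_strict_left_mono; simp)+
    then have low: "-1 < (1 - \<phi>) * t" and up: "(1 - \<phi>) * t < \<phi> - 1"
      using golden_square by (simp_all add: algebra_simps)
    show ?case
    proof (cases "m \<in> S")
      case True
      have "(\<Sum>i\<in>S. (1 - \<phi>) ^ i) = (1 - \<phi>) ^ m * (1 + (1 - \<phi>) * t)"
        using sum.remove[OF fin True, of "\<lambda>i. (1 - \<phi>) ^ i"] t(1) by (simp add: algebra_simps)
      then show ?thesis using low up by (intro exI[of _ "1 + (1 - \<phi>) * t"]) auto
    next
      case False
      then have "(\<Sum>i\<in>S. (1 - \<phi>) ^ i) = (1 - \<phi>) ^ m * ((1 - \<phi>) * t)"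
        using t(1) by simp
      then show ?thesis using low up by (intro exI[of _ "(1 - \<phi>) * t"]) auto
    qed
  qed
  moreover have "S \<subseteq> {m..<m + Suc (Max S)}"
    using assms Max_ge[OF assms(1)] by (force simp: less_Suc_eq_le trans_le_add2)
  ultimately show ?thesis by blast
qed

text \<open>
  For \<open>m = 2\<close> the previous bound confines the sum of conjugate powers to the interval of \<open>T\<close>,
  where \<open>fib_shift_unique\<close> applies. In particular all representations of \<open>k\<close> are shifted to
  representations of one and the same number.
\<close>

lemma sum_fib_Suc_eq_fib_shift:
  assumes "finite S" "S \<subseteq> {2..}"
  shows "(\<Sum>i\<in>S. fib (Suc i)) = fib_shift (\<Sum>i\<in>S. fib i)"
proof (rule fib_shift_unique)
  have "real (\<Sum>i\<in>S. fib (Suc i)) - real (\<Sum>i\<in>S. fib i) * \<phi> = (\<Sum>i\<in>S. (1 - \<phi>) ^ i)"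
    by (simp flip: fib_Suc_conjugate add: sum_subtractf sum_distrib_left mult.commute)
  moreover obtain t where t: "(\<Sum>i\<in>S. (1 - \<phi>) ^ i) = (1 - \<phi>)^2 * t" "-1 < t" "t < \<phi>"
    using conjugate_power_sum_bounds[OF assms] by blast
  moreover have sq: "(1 - \<phi>)^2 = 2 - \<phi>"
    using golden_square by (simp add: power2_eq_square algebra_simps)
  moreover have "(2 - \<phi>) * t < (2 - \<phi>) * \<phi>" "(2 - \<phi>) * (-1) < (2 - \<phi>) * t"
    using t(2,3) golden_bounds by (intro mult_strict_left_mono; simp)+
  moreover have "(2 - \<phi>) * \<phi> = \<phi> - 1" using golden_square by (simp add: algebra_simps)
  ultimately show "\<phi> - 2 < real (\<Sum>i\<in>S. fib (Suc i)) - real (\<Sum>i\<in>S. fib i) * \<phi>"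
    "real (\<Sum>i\<in>S. fib (Suc i)) - real (\<Sum>i\<in>S. fib i) * \<phi> < \<phi> - 1" by simp_all
qed

text \<open>
  Lowering all indices by one inverts the shift: a representation with indices at least 3 is
  the shift of a representation of some \<open>k\<close>, and then it represents \<open>fib_shift k\<close>.
\<close>

lemma fib_reps_3_preimage:
  assumes "S \<in> fib_reps 3 n"
  obtains S' where "S = Suc ` S'" "S' \<in> fib_reps 2 (\<Sum>i\<in>S'. fib i)" "n = fib_shift (\<Sum>i\<in>S'. fib i)"
proof -
  define S' where "S' = Suc -` S"
  have S: "finite S" "S \<subseteq> {3..}" "(\<Sum>i\<in>S. fib i) = n" using assms by (auto simp: fib_reps_def)
  have im: "S = Suc ` S'"
  proof
    show "S \<subseteq> Suc ` S'"
    proof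
      fix i assume i: "i \<in> S"
      then have "i = Suc (i - 1)" using S(2) by force
      then show "i \<in> Suc ` S'" using i unfolding S'_def by (metis image_eqI vimageI)
    qed
  qed (auto simp: S'_def)
  have S': "finite S'" "S' \<subseteq> {2..}"
    using S unfolding S'_def by (auto intro: finite_vimageI)
  have "n = (\<Sum>i\<in>S'. fib (Suc i))" using S(3) im by (simp add: sum.reindex)
  then have "n = fib_shift (\<Sum>i\<in>S'. fib i)" using sum_fib_Suc_eq_fib_shift[OF S'] by simp
  moreover have "S' \<in> fib_reps 2 (\<Sum>i\<in>S'. fib i)" using S' by (simp add: fib_reps_def)
  ultimately show thesis using im that by blast
qed

lemma card_fib_reps_3_shift: "card (fib_reps 3 (fib_shift k)) = R k"
proof -
  have "fib_reps 3 (fib_shift k) = image Suc ` fib_reps 2 k"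
  proof
    show "fib_reps 3 (fib_shift k) \<subseteq> image Suc ` fib_reps 2 k"
    proof
      fix S assume "S \<in> fib_reps 3 (fib_shift k)"
      then obtain S' where S': "S = Suc ` S'" "S' \<in> fib_reps 2 (\<Sum>i\<in>S'. fib i)"
        "fib_shift k = fib_shift (\<Sum>i\<in>S'. fib i)" by (rule fib_reps_3_preimage)
      then have "k = (\<Sum>i\<in>S'. fib i)"
        using strict_mono_eq[OF strict_mono_fib_shift] by blast
      then show "S \<in> image Suc ` fib_reps 2 k" using S' by blast
    qed
    show "image Suc ` fib_reps 2 k \<subseteq> fib_reps 3 (fib_shift k)"
      using sum_fib_Suc_eq_fib_shift by (auto simp: fib_reps_def sum.reindex)
  qed
  then show ?thesis by (simp add: R_eq_card card_image inj_on_def inj_image_eq_iff)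
qed

lemma card_fib_reps_3_gap: "n \<notin> range fib_shift \<Longrightarrow> card (fib_reps 3 n) = 0"
  by (metis card.empty equals0I fib_reps_3_preimage rangeI)

text \<open>
  The next three lemmas evaluate \<open>R_Suc\<close> at the numbers \<open>fib_shift j + 1\<close> and
  \<open>fib_shift (Suc j)\<close>. Which of its two summands vanish depends only on whether
  \<open>fib_shift\<close> jumps by 2 or by 1 after \<open>j\<close>, that is, on the side of \<open>2\<phi> - 3\<close> on which
  the orbit point lies.
\<close>

lemma R_shift_Suc_gap:
  assumes "(T ^^ j) 0 < 2*\<phi> - 3"
  shows "R (fib_shift j + 1) = R j"
  using R_Suc[of "fib_shift j"] card_fib_reps_3_shift card_fib_reps_3_gap[OF fib_shift_gap[OF assms]]
  by simp

lemma R_shift_Suc_adjacent: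
  assumes "2*\<phi> - 3 < (T ^^ j) 0"
  shows "R (fib_shift (Suc j)) = R (Suc j) + R j"
  using R_Suc[of "fib_shift j"] card_fib_reps_3_shift[of "Suc j"] card_fib_reps_3_shift[of j] assms
  by simp

lemma R_shift_Suc_isolated:
  assumes "(T ^^ j) 0 < 2*\<phi> - 3"
  shows "R (fib_shift (Suc j)) = R (Suc j)"
  using R_Suc[of "fib_shift j + 1"] card_fib_reps_3_shift[of "Suc j"]
    card_fib_reps_3_gap[OF fib_shift_gap[OF assms]] assms
  by simp

lemma R_pos: "0 < R n"
proof (induction n rule: less_induct)
  case (less n)
  show ?case
  proof (cases n rule: fib_shift_covers)
    case (1 j)
    show ?thesis
    proof (cases j)
      case 0
      then show ?thesis using 1 R_zero by simp
    next
      case (Suc i)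
      then have "0 < R j" using less.IH[of j] less_fib_shift[of j] 1 by (simp del: fib_shift.simps)
      moreover have "R j \<le> R n"
        using R_shift_Suc_isolated[of i] R_shift_Suc_adjacent[of i] orbit_range(3)[of i] 1 Suc
        by (cases "(T ^^ i) 0 < 2*\<phi> - 3") auto
      ultimately show ?thesis by simp
    qed
  next
    case (2 j)
    then show ?thesis
      using less[of j] less_fib_shift[of j] R_shift_Suc_gap[of j] by (cases "j = 0") auto
  qed
qed

section \<open>Every solution of the functional equations along the orbit\<close>

text \<open>
  Going from \<open>j\<close> to \<open>fib_shift j\<close> multiplies the orbit point by \<open>1 - \<phi> = -1/\<phi>\<close>: the
  conjugates of all parts get one more factor \<open>1 - \<phi>\<close>. This is the inverse of the map
  \<open>y \<mapsto> -\<phi>y\<close> in the functional equations.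
\<close>

lemma orbit_fib_shift: "(T ^^ fib_shift j) 0 = (1 - \<phi>) * (T ^^ j) 0"
proof -
  let ?z = "(T ^^ j) 0"
  have eq: "real (fib_shift j + j) - real (fib_shift j) * \<phi> = (1 - \<phi>) * ?z"
    using golden_square unfolding orbit_eq by (simp add: algebra_simps) algebra
  have "(\<phi> - 1) * ?z < (\<phi> - 1) * (\<phi> - 1)" "(\<phi> - 1) * (\<phi> - 2) < (\<phi> - 1) * ?z"
    using orbit_range[of j] golden_bounds by (auto intro!: mult_strict_left_mono)
  then have "\<phi> - 2 < (1 - \<phi>) * ?z" "(1 - \<phi>) * ?z < \<phi> - 1"
    using golden_square golden_bounds by (simp_all add: algebra_simps)
  then have "fib_shift j + j = fib_shift (fib_shift j)"
    unfolding eq[symmetric] by (rule fib_shift_unique)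
  then show ?thesis using eq unfolding orbit_eq[of "fib_shift j"] by simp
qed

lemma orbit_fib_shift_Suc:
  assumes "(T ^^ j) 0 < 2*\<phi> - 3"
  shows "(T ^^ (fib_shift j + 1)) 0 = (1 - \<phi>) * (T ^^ j) 0 + 2 - \<phi>"
proof -
  have "(\<phi> - 1) * (\<phi> - 2) < (\<phi> - 1) * (T ^^ j) 0"
    using orbit_range[of j] golden_bounds by (auto intro!: mult_strict_left_mono)
  then have "(T ^^ fib_shift j) 0 < 2*\<phi> - 3"
    unfolding orbit_fib_shift using golden_square by (simp add: algebra_simps)
  then show ?thesis using orbit_fib_shift[of j] by (simp add: T_golden)
qed

text \<open>
  Let \<open>z\<close> be the orbit point of index \<open>j\<close>. For \<open>k = fib_shift j\<close> the four pieces of the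
  equations correspond to the position of \<open>z\<close>: if \<open>z > 2\<phi> - 3\<close>, then \<open>R k = R j\<close> and
  \<open>R (k + 1) = R (j + 1) + R j\<close>, which is the equation \<open>h = 1 + h(-\<phi>y)\<close>; if
  \<open>0 \<le> z < 2\<phi> - 3\<close>, then \<open>R k = R (k + 1) = R j\<close>; and if \<open>z < 0\<close>, then \<open>z\<close> is the successor
  of an orbit point above \<open>2\<phi> - 3\<close>, of index \<open>j - 1\<close>, and \<open>R k = R j + R (j - 1)\<close>,
  \<open>R (k + 1) = R j\<close>, which is the equation for \<open>h/(1+h)\<close>. For \<open>k = fib_shift j + 1\<close> outside
  the range of \<open>fib_shift\<close> the ratios at \<open>k\<close> and \<open>j\<close> coincide, which is the last equation.
\<close>

lemma h_equations_orbit: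
  assumes "h_equations f"
  shows "f ((T ^^ k) 0) = real (R (Suc k)) / real (R k)"
proof -
  have A: "f y = 1 + f (-\<phi>*y)" if "\<phi> - 2 < y" "y < 3*\<phi> - 5" for y
    using assms that unfolding h_equations_golden by simp
  have B: "f y = 1" if "3*\<phi> - 5 \<le> y" "y \<le> 0" for y
    using assms that unfolding h_equations_golden by simp
  have C: "f y = f (-\<phi>*y + \<phi> - 1) / (1 + f (-\<phi>*y + \<phi> - 1))" if "0 < y" "y < 2*\<phi> - 3" for y
    using assms that unfolding h_equations_golden by simp
  have D: "f y = f (-\<phi>*y + \<phi> - 1)" if "2*\<phi> - 3 < y" "y < \<phi> - 1" for y
    using assms that unfolding h_equations_golden by simp
  have inv: "-\<phi> * ((1 - \<phi>) * x) = x" for x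
    using golden_square by algebra
  show ?thesis
  proof (induction k rule: less_induct)
    case (less k)
    let ?y = "(T ^^ k) 0"
    show ?case
    proof (cases k rule: fib_shift_covers)
      case (1 j)
      let ?z = "(T ^^ j) 0"
      have y: "?y = (1 - \<phi>) * ?z" using orbit_fib_shift 1 by simp
      have range: "\<phi> - 2 < ?y" "?y < \<phi> - 1" "\<phi> - 2 < ?z" "?z < \<phi> - 1" "?z \<noteq> 2*\<phi> - 3"
        using orbit_range by auto
      have scale: "(1 - \<phi>) * a < (1 - \<phi>) * b" if "b < a" for a b
        using that golden_bounds by (simp add: mult_strict_left_mono_neg)
      consider "2*\<phi> - 3 < ?z" | "0 \<le> ?z" "?z < 2*\<phi> - 3" | "?z < 0"
        using range by linarith
      then show ?thesis
      proof cases
        case 1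
        with \<open>k = fib_shift j\<close> have R: "R (Suc k) = R (Suc j) + R j" 
          using R_shift_Suc_adjacent[of j] by simp
        have j: "j \<noteq> 0" using 1 golden_bounds by (intro notI) simp
        then obtain i where i: "j = Suc i" by (cases j) auto
        have "(T ^^ i) 0 < 2*\<phi> - 3"
          using 1 i orbit_range[of i] golden_bounds by (auto simp: T_golden split: if_splits)
        then have "R k = R j" using R_shift_Suc_isolated[of i] \<open>k = fib_shift j\<close> i by simp
        moreover have "f ?y = 1 + f ?z"
        proof -
          have "?y < 3*\<phi> - 5"
            unfolding y using scale[OF 1] golden_square by (simp add: algebra_simps)
          moreover have "-\<phi> * ?y = ?z" unfolding y inv ..
          ultimately show ?thesis using A[of ?y] range by metis
        qed
        moreover have "f ?z = real (R (Suc j)) / real (R j)"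
          using less less_fib_shift j \<open>k = fib_shift j\<close> by simp
        ultimately show ?thesis using R R_pos[of j] by (simp add: field_simps)
      next
        case 2
        have "R k = R j"
        proof (cases j)
          case 0
          then show ?thesis using \<open>k = fib_shift j\<close> by simp
        next
          case (Suc i)
          then have "(T ^^ i) 0 < 2*\<phi> - 3"
            using 2 orbit_range[of i] golden_bounds by (auto simp: T_golden split: if_splits)
          then show ?thesis using R_shift_Suc_isolated[of i] \<open>k = fib_shift j\<close> Suc by simp
        qed
        moreover have "R (Suc k) = R j" using R_shift_Suc_gap 2 \<open>k = fib_shift j\<close> by simp
        moreover have "?y \<le> 0" unfolding y using 2 golden_bounds by (simp add: mult_nonpos_nonneg)
        moreover have "3*\<phi> - 5 \<le> ?y"
          unfolding y using scale[OF 2(2)] golden_square by (simp add: algebra_simps)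
        ultimately show ?thesis using B[of ?y] R_pos[of j] by simp
      next
        case 3
        then obtain i where i: "j = Suc i" by (cases j) auto
        then have Ti: "?z = T ((T ^^ i) 0)" by simp
        then have x: "2*\<phi> - 3 < (T ^^ i) 0" "?z = (T ^^ i) 0 + 1 - \<phi>"
          using 3 orbit_range[of i] golden_bounds by (auto simp: T_golden split: if_splits)
        have "R k = R (Suc i) + R i"
          using R_shift_Suc_adjacent[OF x(1)] \<open>k = fib_shift j\<close> i by simp
        moreover have "R (Suc k) = R (Suc i)"
          using R_shift_Suc_gap[of j] 3 golden_bounds i \<open>k = fib_shift j\<close> by simp
        moreover have "f ?y = f ((T ^^ i) 0) / (1 + f ((T ^^ i) 0))"
        proof -
          have "0 < ?y" unfolding y using 3 golden_bounds by (simp add: mult_neg_neg)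
          moreover have "?y < 2*\<phi> - 3"
            unfolding y using scale[OF range(3)] golden_square by (simp add: algebra_simps)
          moreover have "-\<phi> * ?y + \<phi> - 1 = (T ^^ i) 0" unfolding y inv using x(2) by simp
          ultimately show ?thesis using C[of ?y] by metis
        qed
        moreover have "f ((T ^^ i) 0) = real (R (Suc i)) / real (R i)"
          using less[of i] less_fib_shift[of j] i \<open>k = fib_shift j\<close> by simp
        ultimately show ?thesis using R_pos[of i] R_pos[of "Suc i"] by (simp add: field_simps)
      qed
    next
      case (2 j)
      let ?z = "(T ^^ j) 0"
      have y: "?y = (1 - \<phi>) * ?z + 2 - \<phi>" using orbit_fib_shift_Suc 2 by simp
      have "(\<phi> - 1) * ?z < (\<phi> - 1) * (2*\<phi> - 3)"
        using 2(2) golden_bounds by (auto intro!: mult_strict_left_mono)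
      then have "2*\<phi> - 3 < ?y" unfolding y using golden_square by (simp add: algebra_simps)
      moreover have "-\<phi> * ?y + \<phi> - 1 = ?z" unfolding y using golden_square by algebra
      ultimately have "f ?y = f ?z" using D[of ?y] orbit_range[of k] by metis
      moreover have "R (Suc k) = R (Suc j)" using R_shift_Suc_isolated[OF 2(2)] 2 by simp
      moreover have "R k = R j" using R_shift_Suc_gap[OF 2(2)] 2 by simp
      moreover have "j < k" using less_fib_shift[of j] 2(1) by (cases "j = 0") auto
      ultimately show ?thesis using less by simp
    qed
  qed
qed

section \<open>Density of the orbit and uniqueness\<close>

text \<open>
  Kronecker's theorem gives an integer combination of 1 and \<open>\<phi>\<close> in the prescribed
  interval; it differs from an orbit point by an integer of absolute value less than one.
\<close>

lemma orbit_dense: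
  assumes "\<phi> - 2 \<le> a" "a < b" "b \<le> \<phi> - 1"
  shows "\<exists>k. (T ^^ k) 0 \<in> {a<..<b}"
proof -
  have irr: "-\<phi> \<notin> \<rat>" using golden_irrational by simp
  have pos: "(b - a)/2 > 0" using assms by simp
  obtain m k :: int where k: "k > 0" "\<bar>of_int k * -\<phi> - of_int m - (a + b)/2\<bar> < (b - a)/2"
    by (rule sequence_of_fractional_parts_is_dense[OF irr pos])
  define x where "x = -of_int m - of_int k * \<phi>"
  have x: "a < x" "x < b" using k(2) unfolding x_def by (auto simp: abs_less_iff field_simps)
  have "of_int (- m - int (fib_shift (nat k))) = x - (T ^^ nat k) 0"
    using k(1) unfolding x_def orbit_eq by simp
  moreover have "\<bar>x - (T ^^ nat k) 0\<bar> < 1" using x assms orbit_range[of "nat k"] by linarith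
  ultimately have "\<bar>real_of_int (- m - int (fib_shift (nat k)))\<bar> < 1" by simp
  then have "- m - int (fib_shift (nat k)) = 0" by linarith
  then have "x = (T ^^ nat k) 0"
    using \<open>of_int (- m - int (fib_shift (nat k))) = x - (T ^^ nat k) 0\<close> by simp
  then show ?thesis using x by auto
qed

lemma h_equations_unique:
  assumes f: "f \<in> extensional h_dom" "continuous_on h_dom f" "h_equations f"
    and g: "g \<in> extensional h_dom" "continuous_on h_dom g" "h_equations g"
  shows "f = g"
proof (rule extensionalityI[OF f(1) g(1)])
  fix y assume y: "y \<in> h_dom"
  have "open h_dom" unfolding h_dom_golden by auto
  have cont: "isCont (\<lambda>x. f x - g x) y"
    using f(2) g(2) y \<open>open h_dom\<close> by (auto simp: continuous_on_eq_continuous_at intro: continuous_diff)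
  show "f y = g y"
  proof (rule ccontr)
    assume "f y \<noteq> g y"
    then obtain e where e: "e > 0" "\<And>x. dist y x < e \<Longrightarrow> f x - g x \<noteq> 0"
      using continuous_at_avoid[OF cont, of 0] by auto
    have "\<phi> - 2 < y" "y < \<phi> - 1" using y golden_bounds unfolding h_dom_golden by auto
    then obtain k where "(T ^^ k) 0 \<in> {y<..<min (y + e) (\<phi> - 1)}"
      using orbit_dense[of y "min (y + e) (\<phi> - 1)"] e(1) by auto
    then have "f ((T ^^ k) 0) \<noteq> g ((T ^^ k) 0)" using e(2)[of "(T ^^ k) 0"] by (auto simp: dist_real_def)
    then show False using h_equations_orbit[OF f(3)] h_equations_orbit[OF g(3)] by simp
  qed
qed

section \<open>Existence of a continuous solution\<close>

text \<open>
  The functional equations for \<open>v = h/(1+h)\<close>, restricted to the left component of the domain: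
  there \<open>h\<close> refers to values at points of the right component, and substituting the last
  equation for these gives the arguments \<open>\<phi>^2 y + 1/\<phi>\<close> and \<open>\<phi>^2 y - 1/\<phi>^2\<close>, written here with
  \<open>\<phi>^2 = \<phi> + 1\<close>. The result is a self-map of functions on one closed interval.
\<close>

definition farey_step :: "(real \<Rightarrow> real) \<Rightarrow> real \<Rightarrow> real" where
  "farey_step v y =
     (if y \<le> 3*\<phi> - 5 then 1 / (2 - v ((\<phi> + 1) * y + \<phi> - 1))
      else if y \<le> 0 then 1/2
      else v ((\<phi> + 1) * y + \<phi> - 2) / (1 + v ((\<phi> + 1) * y + \<phi> - 2)))"

text \<open>
  The two end values are what makes the three pieces of \<open>farey_step\<close> agree at \<open>3\<phi> - 5\<close> and at
  0, so that continuity is preserved; they correspond to \<open>h\<close> tending to \<open>\<infinity>\<close> at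
  \<open>-1/\<phi>^2\<close> and to 0 at \<open>1/\<phi>^3\<close>.
\<close>

definition admissible :: "(real \<Rightarrow> real) \<Rightarrow> bool" where
  "admissible v \<longleftrightarrow> continuous_on {\<phi> - 2 .. 2*\<phi> - 3} v \<and> (\<forall>y \<in> {\<phi> - 2 .. 2*\<phi> - 3}. 0 \<le> v y \<and> v y \<le> 1) \<and>
     v (\<phi> - 2) = 1 \<and> v (2*\<phi> - 3) = 0"

lemma branch_left:
  assumes "\<phi> - 2 \<le> y" "y \<le> 3*\<phi> - 5"
  shows "(\<phi> + 1) * y + \<phi> - 1 \<in> {\<phi> - 2 .. 2*\<phi> - 3}"
proof -
  have "(\<phi> + 1) * (\<phi> - 2) \<le> (\<phi> + 1) * y" "(\<phi> + 1) * y \<le> (\<phi> + 1) * (3*\<phi> - 5)"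
    using assms golden_bounds by (intro mult_left_mono; simp)+
  then show ?thesis using golden_square by (simp add: algebra_simps)
qed

lemma branch_right:
  assumes "0 \<le> y" "y \<le> 2*\<phi> - 3"
  shows "(\<phi> + 1) * y + \<phi> - 2 \<in> {\<phi> - 2 .. 2*\<phi> - 3}"
proof -
  have "0 \<le> (\<phi> + 1) * y" "(\<phi> + 1) * y \<le> (\<phi> + 1) * (2*\<phi> - 3)"
    using assms golden_bounds by (auto intro!: mult_left_mono mult_nonneg_nonneg)
  then show ?thesis using golden_square by (simp add: algebra_simps)
qed

text \<open>
  The difference of the images is \<open>(y - x)/((1 + x)(1 + y))\<close> for \<open>x \<le> y\<close>, and the worst case
  is \<open>x = 0\<close>.
\<close>

lemma farey_branch_contraction:
  fixes a b d :: real
  assumes "0 \<le> a" "0 \<le> b" "\<bar>a - b\<bar> \<le> d"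
  shows "\<bar>a / (1 + a) - b / (1 + b)\<bar> \<le> d / (1 + d)"
proof -
  have *: "y / (1 + y) - x / (1 + x) \<le> d / (1 + d) \<and> 0 \<le> y / (1 + y) - x / (1 + x)"
    if "0 \<le> x" "x \<le> y" "y - x \<le> d" for x y
  proof -
    have "y / (1 + y) - x / (1 + x) = (y - x) / ((1 + x) * (1 + y))"
      using that by (simp add: field_simps)
    also have "\<dots> \<le> (y - x) / (1 + (y - x))"
    proof (rule divide_left_mono)
      have "0 \<le> x * y" using that by simp
      then show "1 + (y - x) \<le> (1 + x) * (1 + y)" using that by (simp add: algebra_simps)
    qed (use that in auto)
    also have "\<dots> \<le> d / (1 + d)" using that by (simp add: field_simps)
    finally show ?thesis using that by (simp add: field_simps)
  qed
  show ?thesis using *[of a b] *[of b a] assms by (cases "a \<le> b") auto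
qed

text \<open>
  The left branch \<open>v \<mapsto> 1/(2-v)\<close> is conjugate to the right branch \<open>v \<mapsto> v/(1+v)\<close> under
  \<open>v \<mapsto> 1 - v\<close>, so one estimate serves for both.
\<close>

lemma farey_step_contraction:
  assumes "admissible v" "admissible w" "0 \<le> d"
    and vw: "\<And>y. y \<in> {\<phi> - 2 .. 2*\<phi> - 3} \<Longrightarrow> \<bar>v y - w y\<bar> \<le> d"
    and y: "y \<in> {\<phi> - 2 .. 2*\<phi> - 3}"
  shows "\<bar>farey_step v y - farey_step w y\<bar> \<le> d / (1 + d)"
proof -
  have range: "0 \<le> v x \<and> v x \<le> 1 \<and> 0 \<le> w x \<and> w x \<le> 1" if "x \<in> {\<phi> - 2 .. 2*\<phi> - 3}" for x
    using assms(1,2) that unfolding admissible_def by blast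
  consider "y \<le> 3*\<phi> - 5" | "3*\<phi> - 5 < y" "y \<le> 0" | "3*\<phi> - 5 < y" "0 < y" by linarith
  then show ?thesis
  proof cases
    case 1
    define x where "x = (\<phi> + 1) * y + \<phi> - 1"
    have x: "x \<in> {\<phi> - 2 .. 2*\<phi> - 3}" using branch_left y 1 unfolding x_def by simp
    have flip: "1 / (2 - a) = 1 - (1 - a) / (1 + (1 - a))" if "a \<le> 1" for a :: real
      using that by (simp add: field_simps)
    have "\<bar>(1 - v x) / (1 + (1 - v x)) - (1 - w x) / (1 + (1 - w x))\<bar> \<le> d / (1 + d)"
      using range[OF x] vw[OF x] by (intro farey_branch_contraction) auto
    then have "\<bar>1 / (2 - v x) - 1 / (2 - w x)\<bar> \<le> d / (1 + d)"
      using range[OF x] by (simp only: flip)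
    then show ?thesis using 1 unfolding farey_step_def x_def by simp
  next
    case 2
    then show ?thesis using assms(3) unfolding farey_step_def by simp
  next
    case 3
    define x where "x = (\<phi> + 1) * y + \<phi> - 2"
    have x: "x \<in> {\<phi> - 2 .. 2*\<phi> - 3}" using branch_right y 3 unfolding x_def by simp
    have "\<bar>v x / (1 + v x) - w x / (1 + w x)\<bar> \<le> d / (1 + d)"
      using range[OF x] vw[OF x] by (intro farey_branch_contraction) auto
    then show ?thesis using 3 unfolding farey_step_def x_def by simp
  qed
qed

lemma admissible_farey_step:
  assumes "admissible v"
  shows "admissible (farey_step v)"
proof -
  let ?J = "{\<phi> - 2 .. 2*\<phi> - 3}"
  have cont: "continuous_on ?J v" and ends: "v (\<phi> - 2) = 1" "v (2*\<phi> - 3) = 0"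
    and range: "\<And>x. x \<in> ?J \<Longrightarrow> 0 \<le> v x \<and> v x \<le> 1"
    using assms unfolding admissible_def by auto
  have pts: "(\<phi> + 1) * (\<phi> - 2) + \<phi> - 1 = \<phi> - 2" "(\<phi> + 1) * (3*\<phi> - 5) + \<phi> - 1 = 2*\<phi> - 3"
    "(\<phi> + 1) * (2*\<phi> - 3) + \<phi> - 2 = 2*\<phi> - 3"
    using golden_square by (simp_all add: algebra_simps)
  have range_left: "0 \<le> v ((\<phi> + 1) * y + \<phi> - 1) \<and> v ((\<phi> + 1) * y + \<phi> - 1) \<le> 1"
    if "\<phi> - 2 \<le> y" "y \<le> 3*\<phi> - 5" for y using range branch_left that by blast
  have range_right: "0 \<le> v ((\<phi> + 1) * y + \<phi> - 2) \<and> v ((\<phi> + 1) * y + \<phi> - 2) \<le> 1"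
    if "0 \<le> y" "y \<le> 2*\<phi> - 3" for y using range branch_right that by blast
  have left: "continuous_on {y \<in> ?J. y \<le> 3*\<phi> - 5} (\<lambda>y. 1 / (2 - v ((\<phi> + 1) * y + \<phi> - 1)))"
    using branch_left range_left
    by (intro continuous_intros continuous_on_compose2[OF cont]) (auto, fastforce)
  have right: "continuous_on {y \<in> {y \<in> ?J. 3*\<phi> - 5 \<le> y}. 0 \<le> y}
      (\<lambda>y. v ((\<phi> + 1) * y + \<phi> - 2) / (1 + v ((\<phi> + 1) * y + \<phi> - 2)))"
    using branch_right range_right
    by (intro continuous_intros continuous_on_compose2[OF cont]) (auto, fastforce)
  have "continuous_on ?J (farey_step v)"
    unfolding farey_step_def[abs_def]
  proof (intro continuous_on_cases_le left right ballI impI continuous_on_id continuous_on_const)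
    fix y assume "y \<in> {y \<in> ?J. 3*\<phi> - 5 \<le> y}" "y = 0"
    then show "1/2 = v ((\<phi> + 1) * y + \<phi> - 2) / (1 + v ((\<phi> + 1) * y + \<phi> - 2))"
      using ends by simp
  next
    fix y assume y: "y \<in> ?J" "y = 3*\<phi> - 5"
    then have "y \<le> 0" using golden_bounds by simp
    moreover have "v ((\<phi> + 1) * y + \<phi> - 1) = 0" unfolding y(2) pts(2) by (rule ends(2))
    ultimately show "1 / (2 - v ((\<phi> + 1) * y + \<phi> - 1)) =
      (if y \<le> 0 then 1/2 else v ((\<phi> + 1) * y + \<phi> - 2) / (1 + v ((\<phi> + 1) * y + \<phi> - 2)))"
      by simp
  qed
  moreover have "0 \<le> farey_step v y \<and> farey_step v y \<le> 1" if "y \<in> ?J" for y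
    using range_left[of y] range_right[of y] that unfolding farey_step_def
    by (auto simp: divide_simps)
  moreover have "farey_step v (\<phi> - 2) = 1" "farey_step v (2*\<phi> - 3) = 0"
    unfolding farey_step_def pts using ends golden_bounds by auto
  ultimately show ?thesis unfolding admissible_def by blast
qed

text \<open>
  Starting from the linear interpolation of the end values, the distance between the iterates
  \<open>n\<close> and \<open>n + k\<close> is bounded by the \<open>n\<close>-th iterate of \<open>d \<mapsto> d/(1+d)\<close> at 1, that is, by
  \<open>1/(n+1)\<close>. The convergence is uniform, hence the limit is continuous.
\<close>

lemma farey_step_fixed_point:
  obtains v where "admissible v" "\<And>y. y \<in> {\<phi> - 2 .. 2*\<phi> - 3} \<Longrightarrow> farey_step v y = v y"
proof -
  let ?J = "{\<phi> - 2 .. 2*\<phi> - 3}"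
  define V where "V n = (farey_step ^^ n) (\<lambda>y. (2*\<phi> - 3 - y) / (\<phi> - 1))" for n
  have V_Suc: "V (Suc n) = farey_step (V n)" for n unfolding V_def by simp
  have "admissible (V 0)"
    using golden_bounds unfolding admissible_def V_def
    by (auto intro!: continuous_intros simp: field_simps)
  then have adm: "admissible (V n)" for n
    by (induction n) (auto simp: V_Suc intro: admissible_farey_step)
  have close: "\<bar>V n y - V (n + k) y\<bar> \<le> 1 / real (Suc n)" if "y \<in> ?J" for n k y
    using that
  proof (induction n arbitrary: y)
    case 0
    then have "0 \<le> V 0 y" "V 0 y \<le> 1" "0 \<le> V k y" "V k y \<le> 1"
      using adm[of 0] adm[of k] unfolding admissible_def by auto
    then show ?case by simp
  next
    case (Suc n)
    have "\<bar>farey_step (V n) y - farey_step (V (n + k)) y\<bar> \<le> (1 / real (Suc n)) / (1 + 1 / real (Suc n))"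
      using Suc by (intro farey_step_contraction adm) auto
    also have "\<dots> = 1 / real (Suc (Suc n))" by (simp add: field_simps)
    finally show ?case by (simp add: V_Suc)
  qed
  have "uniformly_Cauchy_on ?J V"
  proof (rule uniformly_Cauchy_onI')
    fix e :: real assume "e > 0"
    then obtain M where M: "1 / real (Suc M) < e" using nat_approx_posE by blast
    have "dist (V m y) (V n y) < e" if "y \<in> ?J" "M \<le> m" "m < n" for y m n
    proof -
      have "dist (V m y) (V n y) \<le> 1 / real (Suc m)"
        using close[OF that(1), of m "n - m"] that(3) by (simp add: dist_real_def)
      also have "\<dots> \<le> 1 / real (Suc M)" using that(2) by (simp add: frac_le)
      finally show ?thesis using M by simp
    qed
    then show "\<exists>M. \<forall>y\<in>?J. \<forall>m\<ge>M. \<forall>n>m. dist (V m y) (V n y) < e" by blast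
  qed
  then obtain v where v: "uniform_limit ?J V v sequentially"
    using Cauchy_uniformly_convergent unfolding uniformly_convergent_on_def by blast
  have lim: "(\<lambda>n. V n y) \<longlonglongrightarrow> v y" if "y \<in> ?J" for y
    using tendsto_uniform_limitI[OF v that] .
  have J_ends: "\<phi> - 2 \<in> ?J" "2*\<phi> - 3 \<in> ?J" using golden_bounds by auto
  have range: "0 \<le> v y \<and> v y \<le> 1" if "y \<in> ?J" for y
  proof
    show "0 \<le> v y"
      by (rule LIMSEQ_le_const[OF lim[OF that]]) (use adm that in \<open>auto simp: admissible_def\<close>)
    show "v y \<le> 1"
      by (rule LIMSEQ_le_const2[OF lim[OF that]]) (use adm that in \<open>auto simp: admissible_def\<close>)
  qed
  have "continuous_on ?J v"
    by (rule uniform_limit_theorem[OF _ v]) (use adm in \<open>auto simp: admissible_def\<close>)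
  moreover have "v (\<phi> - 2) = 1" "v (2*\<phi> - 3) = 0"
    using lim[OF J_ends(1)] lim[OF J_ends(2)] adm by (simp_all add: admissible_def LIMSEQ_const_iff)
  ultimately have adm_v: "admissible v" using range unfolding admissible_def by blast
  have "farey_step v y = v y" if y: "y \<in> ?J" for y
  proof (rule LIMSEQ_unique)
    show "(\<lambda>n. farey_step (V n) y) \<longlonglongrightarrow> v y"
      using LIMSEQ_Suc[OF lim[OF y]] by (simp add: V_Suc)
    consider "y \<le> 3*\<phi> - 5" | "3*\<phi> - 5 < y" "y \<le> 0" | "3*\<phi> - 5 < y" "0 < y" by linarith
    then show "(\<lambda>n. farey_step (V n) y) \<longlonglongrightarrow> farey_step v y"
    proof cases
      case 1
      then have x: "(\<phi> + 1) * y + \<phi> - 1 \<in> ?J" using branch_left y by simp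
      then show ?thesis using 1 range[OF x] unfolding farey_step_def
        by (auto intro!: tendsto_intros lim)
    next
      case 2
      then show ?thesis unfolding farey_step_def by simp
    next
      case 3
      then have x: "(\<phi> + 1) * y + \<phi> - 2 \<in> ?J" using branch_right y by simp
      then show ?thesis using 3 range[OF x] unfolding farey_step_def
        by (auto intro!: tendsto_intros lim)
    qed
  qed
  with adm_v show thesis by (rule that)
qed

text \<open>
  The value 1 can only be taken on the left branch, where \<open>v y = 1\<close> forces the value 1 at a
  point whose distance to \<open>\<phi> - 2\<close> is larger by the factor \<open>\<phi>^2\<close>. After finitely many steps
  such a point would leave the left branch. The induction is on the number of steps.
\<close>

lemma farey_fixed_point_less_1:
  assumes adm: "admissible v" and fp: "\<And>y. y \<in> {\<phi> - 2 .. 2*\<phi> - 3} \<Longrightarrow> farey_step v y = v y"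
    and y: "\<phi> - 2 < y" "y \<le> 2*\<phi> - 3"
  shows "v y < 1"
proof -
  have range: "0 \<le> v x \<and> v x \<le> 1" if "x \<in> {\<phi> - 2 .. 2*\<phi> - 3}" for x
    using adm that unfolding admissible_def by blast
  have far: "v y < 1" if "\<phi> - 2 < y" "y \<le> 2*\<phi> - 3" "2*\<phi> - 3 < (\<phi> + 1)^n * (y + 2 - \<phi>)" for n y
    using that
  proof (induction n arbitrary: y)
    case 0
    then have "3*\<phi> - 5 < y" using golden_bounds by simp
    have "0 \<le> v ((\<phi> + 1) * y + \<phi> - 2)" if "0 < y"
      using range[OF branch_right] that 0 by simp
    then have "farey_step v y < 1" using \<open>3*\<phi> - 5 < y\<close> unfolding farey_step_def by (auto simp: field_simps)
    then show ?case using fp[of y] 0 by simp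
  next
    case (Suc n)
    show ?case
    proof (cases "y \<le> 3*\<phi> - 5")
      case True
      let ?x = "(\<phi> + 1) * y + \<phi> - 1"
      have x: "?x \<in> {\<phi> - 2 .. 2*\<phi> - 3}" using branch_left True Suc.prems by simp
      have eq: "?x + 2 - \<phi> = (\<phi> + 1) * (y + 2 - \<phi>)" using golden_square by (simp add: algebra_simps)
      then have "0 < ?x + 2 - \<phi>" using Suc.prems(1) golden_bounds by simp
      moreover have "2*\<phi> - 3 < (\<phi> + 1)^n * (?x + 2 - \<phi>)"
        using Suc.prems(3) unfolding eq by (simp add: mult_ac)
      ultimately have "v ?x < 1" using Suc.IH[of ?x] x by simp
      then have "farey_step v y < 1" using True unfolding farey_step_def by simp
      then show ?thesis using fp[of y] Suc.prems by simp
    next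
      case False
      have "0 \<le> v ((\<phi> + 1) * y + \<phi> - 2)" if "0 < y"
        using range[OF branch_right] that Suc.prems by simp
      then have "farey_step v y < 1" using False unfolding farey_step_def by (auto simp: field_simps)
      then show ?thesis using fp[of y] Suc.prems by simp
    qed
  qed
  have "1 < \<phi> + 1" "0 < y + 2 - \<phi>" using golden_bounds y by auto
  obtain n where "(2*\<phi> - 3) / (y + 2 - \<phi>) < (\<phi> + 1)^n"
    using real_arch_pow[OF \<open>1 < \<phi> + 1\<close>] by blast
  then have "2*\<phi> - 3 < (\<phi> + 1)^n * (y + 2 - \<phi>)" using \<open>0 < y + 2 - \<phi>\<close> by (simp add: pos_divide_less_eq)
  then show ?thesis using far y by blast
qed

text \<open>
  Undoing the change of coordinate needs \<open>v < 1\<close>, which holds away from the left end. On the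
  right component the last equation serves as the definition.
\<close>

lemma h_exists: "\<exists>f. f \<in> extensional h_dom \<and> continuous_on h_dom f \<and> h_equations f"
proof -
  obtain v where adm: "admissible v"
    and fp: "\<And>y. y \<in> {\<phi> - 2 .. 2*\<phi> - 3} \<Longrightarrow> farey_step v y = v y"
    using farey_step_fixed_point by blast
  have less1: "v y < 1" if "\<phi> - 2 < y" "y \<le> 2*\<phi> - 3" for y
    using farey_fixed_point_less_1[OF adm fp] that by blast
  have nonneg: "0 \<le> v y" if "\<phi> - 2 < y" "y \<le> 2*\<phi> - 3" for y
    using adm that unfolding admissible_def by auto
  define g where "g y = v y / (1 - v y)" for y
  define f where "f = restrict (\<lambda>y. if y < 2*\<phi> - 3 then g y else g (-\<phi>*y + \<phi> - 1)) h_dom"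
  let ?I = "{\<phi> - 2 <..< 2*\<phi> - 3}" and ?D = "{2*\<phi> - 3 <..< \<phi> - 1}"
  have g_cont: "continuous_on ?I g"
  proof -
    have "continuous_on ?I v"
      using adm unfolding admissible_def by (auto elim: continuous_on_subset)
    then show ?thesis unfolding g_def using less1 by (intro continuous_intros) (auto, fastforce)
  qed
  have D_to_I: "-\<phi>*y + \<phi> - 1 \<in> ?I" if "y \<in> ?D" for y
  proof -
    have "\<phi> * (2*\<phi> - 3) < \<phi> * y" "\<phi> * y < \<phi> * (\<phi> - 1)"
      using that golden_bounds by (auto intro!: mult_strict_left_mono)
    then show ?thesis using golden_square by (simp add: algebra_simps)
  qed
  have f_I: "f y = g y" if "y \<in> ?I" for y using that unfolding f_def h_dom_golden by simp
  have f_D: "f y = f (-\<phi>*y + \<phi> - 1)" if "y \<in> ?D" for y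
    using that f_I[OF D_to_I[OF that]] unfolding f_def h_dom_golden by simp
  have f_rescale: "f (-\<phi>*y) = g ((\<phi> + 1) * y + \<phi> - 1)" if "-\<phi>*y \<in> ?D" for y
  proof -
    have "-\<phi> * (-\<phi>*y) + \<phi> - 1 = (\<phi> + 1) * y + \<phi> - 1" using golden_square by algebra
    then show ?thesis using f_D[OF that] f_I[OF D_to_I[OF that]] by metis
  qed
  have "continuous_on ?I f" using g_cont by (subst continuous_on_cong[OF refl f_I])
  moreover have "continuous_on ?D f"
  proof -
    have "continuous_on ?D (\<lambda>y. g (-\<phi>*y + \<phi> - 1))"
      by (rule continuous_on_compose2[OF g_cont]) (use D_to_I in \<open>auto intro!: continuous_intros\<close>)
    moreover have "f y = g (-\<phi>*y + \<phi> - 1)" if "y \<in> ?D" for y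
      using f_D[OF that] f_I[OF D_to_I[OF that]] by metis
    ultimately show ?thesis by (subst continuous_on_cong[OF refl])
  qed
  ultimately have cont: "continuous_on h_dom f"
    unfolding h_dom_golden by (intro continuous_on_open_Un) auto
  have eqs: "h_equations f"
    unfolding h_equations_golden
  proof (intro conjI ballI)
    fix y assume y: "y \<in> {\<phi> - 2 <..< 3*\<phi> - 5}"
    have "\<phi> * (\<phi> - 2) < \<phi> * y" "\<phi> * y < \<phi> * (3*\<phi> - 5)"
      using y golden_bounds by (auto intro!: mult_strict_left_mono)
    then have D: "-\<phi>*y \<in> ?D" using golden_square by (simp add: algebra_simps)
    let ?x = "(\<phi> + 1) * y + \<phi> - 1"
    have "?x = -\<phi> * (-\<phi>*y) + \<phi> - 1" using golden_square by algebra
    then have x: "?x \<in> ?I" using D_to_I[OF D] by metis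
    have yI: "y \<in> ?I" using y golden_bounds by auto
    then have v: "v y = 1 / (2 - v ?x)" using fp[of y] y unfolding farey_step_def by simp
    have lt: "v ?x < 1" using less1 x by simp
    then have "1 - v y = (1 - v ?x) / (2 - v ?x)" unfolding v by (simp add: divide_simps)
    then have "g y = 1 / (1 - v ?x)" using lt unfolding g_def v by simp
    also have "\<dots> = 1 + g ?x" using lt unfolding g_def by (simp add: divide_simps)
    finally have "g y = 1 + g ?x" .
    then show "f y = 1 + f (-\<phi>*y)" using f_I[OF yI] f_rescale[OF D] by simp
  next
    fix y assume y: "y \<in> {3*\<phi> - 5 .. 0}"
    then have yI: "y \<in> ?I" using golden_bounds by auto
    have "(\<phi> + 1) * (3*\<phi> - 5) + \<phi> - 1 = 2*\<phi> - 3" using golden_square by (simp add: algebra_simps)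
    then have "v ((\<phi> + 1) * (3*\<phi> - 5) + \<phi> - 1) = 0" using adm unfolding admissible_def by metis
    then have "1 / (2 - v ((\<phi> + 1) * y + \<phi> - 1)) = 1/2" if "y = 3*\<phi> - 5"
      unfolding that by simp
    then have "farey_step v y = 1/2"
      using y unfolding farey_step_def by (cases "y = 3*\<phi> - 5") auto
    then have "v y = 1/2" using fp[of y] yI by simp
    then show "f y = 1" using f_I[OF yI] unfolding g_def by simp
  next
    fix y assume y: "y \<in> {0 <..< 2*\<phi> - 3}"
    then have yI: "y \<in> ?I" using golden_bounds by auto
    let ?z = "-\<phi>*y + \<phi> - 1" and ?x = "(\<phi> + 1) * y + \<phi> - 2"
    have "\<phi> * 0 < \<phi> * y" "\<phi> * y < \<phi> * (2*\<phi> - 3)"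
      using y golden_bounds by (auto intro!: mult_strict_left_mono)
    then have D: "?z \<in> ?D" using golden_square by (simp add: algebra_simps)
    have zx: "-\<phi> * ?z + \<phi> - 1 = ?x" using golden_square by algebra
    have x: "?x \<in> ?I" using D_to_I[OF D] unfolding zx .
    have fz: "f ?z = g ?x" using f_D[OF D] f_I[OF x] unfolding zx by simp
    have v: "v y = v ?x / (1 + v ?x)" using fp[of y] yI y golden_bounds unfolding farey_step_def by simp
    have "0 \<le> v ?x" "v ?x < 1" using less1 nonneg x by auto
    then have "1 - v y = 1 / (1 + v ?x)" "1 + g ?x = 1 / (1 - v ?x)"
      unfolding v g_def by (simp_all add: divide_simps)
    then have "g y = v ?x" "g ?x / (1 + g ?x) = v ?x"
      using \<open>0 \<le> v ?x\<close> \<open>v ?x < 1\<close> unfolding g_def v by simp_all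
    then have "g y = g ?x / (1 + g ?x)" by simp
    then show "f y = f ?z / (1 + f ?z)" using f_I[OF yI] fz by simp
  next
    fix y assume "y \<in> ?D"
    then show "f y = f (-\<phi>*y + \<phi> - 1)" by (rule f_D)
  qed
  have "f \<in> extensional h_dom" unfolding f_def by simp
  with cont eqs show ?thesis by blast
qed

lemma h_equations_h: "h_equations h"
proof -
  have "\<exists>!f. f \<in> extensional h_dom \<and> continuous_on h_dom f \<and> h_equations f"
    using h_exists h_equations_unique by blast
  from theI'[OF this] show ?thesis unfolding h_def by blast
qed

theorem theorem1p1:
  fixes n :: nat
  assumes "n \<ge> 1"
  shows "real (R n) = exp (\<Sum>k = 0..n - 1. ln (h ((T ^^ k) 0)))"
proof -
  have "real (R n) = exp (\<Sum>k<n. ln (h ((T ^^ k) 0)))"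
  proof (induction n)
    case 0
    then show ?case by (simp add: R_zero)
  next
    case (Suc n)
    have "h ((T ^^ n) 0) = real (R (Suc n)) / real (R n)"
      by (rule h_equations_orbit[OF h_equations_h])
    then show ?case using R_pos[of n] R_pos[of "Suc n"] Suc by (simp add: exp_add)
  qed
  moreover have "{0..n - 1} = {..<n}" using assms by auto
  ultimately show ?thesis by simp
qed

end
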